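(* Let $\mathcal F$ be a multigraph family with generating function $F(z,w)$, and for integers $n,m\ge 0$ let $\operatorname{MG}^{[\mathcal F]}_{n,m}$ be the number of pairs $(G,H)$ where $G$ is an $(n,m)$-multigraph and $H$ is an $\mathcal F$-subgraph of $G$ (if the members of $\mathcal F$ carry weights and $F$ is the corresponding weighted generating function, $\operatorname{MG}^{[\mathcal F]}_{n,m}$ denotes the total weight of such pairs, the weight of $(G,H)$ being the weight of the distinguished copy $H$). (i) For all $n,m$, \[ \operatorname{MG}^{[\mathcal F]}_{n,m} = n!\,2^m\,m!\,[z^n w^m]\, F(z,w)\, e^{z}\, e^{n^2 w/2}. \] (ii) Assume that $F(z,w)$ is entire in both variables. Let $D$ be an open set containing the closed unit disk. Let $n\to\infty$ and $m=m(n)\to\infty$ be such that $\frac{F(nz,\,2mw/n^2)}{F(n,\,2m/n^2)}$ converges, uniformly on each compact subset of $D^2$, to an analytic function $L(z,w)$ on $D^2$. Then \[ \operatorname{MG}^{[\mathcal F]}_{n,m} \sim n^{2m}\, F\!\left(n,\frac{2m}{n^2}\right). \]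
   Context: A multigraph $G$ consists of a finite set $V(G)$ of vertices carrying distinct integer labels and a finite set $E(G)$ of edges, each edge being a triple $(v,w,e)$ with $v,w\in V(G)$ (the edge is oriented from $v$ to $w$; $v=w$ is allowed, a loop) and $e$ an integer edge label, edge labels being distinct; multiple edges are allowed. An $(n,m)$-multigraph is a multigraph with vertex labels exactly $1,\dots,n$ and edge labels exactly $1,\dots,m$ (canonical labeling); there are $n^{2m}$ of them. Two multigraphs $G,H$ are isomorphic if there are bijections $\alpha:V(G)\to V(H)$ and $\beta:E(G)\to E(H)$ such that $\beta$ maps the edges from $v$ to $w$ onto the edges from $\alpha(v)$ to $\alpha(w)$, for all $v,w$ (labels are ignored). $F$ is a subgraph of $G$ if $V(F)\subset V(G)$ and $E(F)\subset E(G)$. A multigraph family $\mathcal F$ is a set of canonically labeled multigraphs (vertex labels $1,\dots,n(H)$, edge labels $1,\dots,m(H)$), closed under isomorphism among canonically labeled multigraphs; an $\mathcal F$-subgraph of $G$ is a subgraph of $G$ isomorphic to an element of $\mathcal F$. Its generating function is $F(z,w)=\sum_{H\in\mathcal F}\frac{w^{m(H)}}{2^{m(H)}m(H)!}\frac{z^{n(H)}}{n(H)!}$, where $n(H),m(H)$ are the numbers of vertices and edges. *)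

theory Defs
  imports "HOL-Analysis.Analysis" "HOL-Computational_Algebra.Formal_Power_Series"
    "HOL-Library.Landau_Symbols"
begin

text \<open>Vertices are identified with their labels; an edge is a triple
  (source, target, edge label).\<close>

record mgraph =
  verts :: "int set"
  edges :: "(int \<times> int \<times> int) set"

definition edge_label :: "int \<times> int \<times> int \<Rightarrow> int" where
  "edge_label = (\<lambda>(v, w, e). e)"

definition multigraph :: "mgraph \<Rightarrow> bool" where
  "multigraph G \<longleftrightarrow> finite (verts G) \<and> finite (edges G) \<and>
     (\<forall>(v, w, e) \<in> edges G. v \<in> verts G \<and> w \<in> verts G) \<and>
     inj_on edge_label (edges G)"

definition nm_multigraph :: "nat \<Rightarrow> nat \<Rightarrow> mgraph \<Rightarrow> bool" where
  "nm_multigraph n m G \<longleftrightarrow> multigraph G \<and>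
     verts G = {1..int n} \<and> edge_label ` edges G = {1..int m}"

definition canonical :: "mgraph \<Rightarrow> bool" where
  "canonical G \<longleftrightarrow> (\<exists>n m. nm_multigraph n m G)"

definition edges_between :: "mgraph \<Rightarrow> int \<Rightarrow> int \<Rightarrow> (int \<times> int \<times> int) set" where
  "edges_between G v w = {(v', w', e) \<in> edges G. v' = v \<and> w' = w}"

definition mg_iso :: "mgraph \<Rightarrow> mgraph \<Rightarrow> bool" where
  "mg_iso G H \<longleftrightarrow> (\<exists>\<alpha> \<beta>. bij_betw \<alpha> (verts G) (verts H) \<and> bij_betw \<beta> (edges G) (edges H) \<and>
     (\<forall>v \<in> verts G. \<forall>w \<in> verts G.
        \<beta> ` edges_between G v w = edges_between H (\<alpha> v) (\<alpha> w)))"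

definition subgraph :: "mgraph \<Rightarrow> mgraph \<Rightarrow> bool" where
  "subgraph H G \<longleftrightarrow> multigraph H \<and> verts H \<subseteq> verts G \<and> edges H \<subseteq> edges G"

definition multigraph_family :: "mgraph set \<Rightarrow> bool" where
  "multigraph_family \<F> \<longleftrightarrow> (\<forall>H \<in> \<F>. canonical H) \<and>
     (\<forall>H \<in> \<F>. \<forall>H'. canonical H' \<and> mg_iso H H' \<longrightarrow> H' \<in> \<F>)"

definition family_subgraph :: "mgraph set \<Rightarrow> mgraph \<Rightarrow> mgraph \<Rightarrow> bool" where
  "family_subgraph \<F> H G \<longleftrightarrow> subgraph H G \<and> (\<exists>K \<in> \<F>. mg_iso H K)"

definition MG_pairs :: "mgraph set \<Rightarrow> nat \<Rightarrow> nat \<Rightarrow> (mgraph \<times> mgraph) set" where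
  "MG_pairs \<F> n m = {(G, H). nm_multigraph n m G \<and> family_subgraph \<F> H G}"

definition MG :: "mgraph set \<Rightarrow> nat \<Rightarrow> nat \<Rightarrow> nat" where
  "MG \<F> n m = card (MG_pairs \<F> n m)"

text \<open>Weights are functions of the isomorphism class, so that a distinguished copy inherits the
  weight of any member of the family isomorphic to it.\<close>

definition iso_invariant_weight :: "mgraph set \<Rightarrow> (mgraph \<Rightarrow> complex) \<Rightarrow> bool" where
  "iso_invariant_weight \<F> \<omega> \<longleftrightarrow> (\<forall>H \<in> \<F>. \<forall>K \<in> \<F>. mg_iso H K \<longrightarrow> \<omega> H = \<omega> K)"

definition copy_weight :: "mgraph set \<Rightarrow> (mgraph \<Rightarrow> complex) \<Rightarrow> mgraph \<Rightarrow> complex" where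
  "copy_weight \<F> \<omega> H = (THE x. \<exists>K \<in> \<F>. mg_iso H K \<and> x = \<omega> K)"

definition weighted_MG :: "mgraph set \<Rightarrow> (mgraph \<Rightarrow> complex) \<Rightarrow> nat \<Rightarrow> nat \<Rightarrow> complex" where
  "weighted_MG \<F> \<omega> n m = (\<Sum>(G, H) \<in> MG_pairs \<F> n m. copy_weight \<F> \<omega> H)"

text \<open>A formal power series in \<open>z\<close> and \<open>w\<close> is an element of C[[z]][[w]]: the outer variable
  is \<open>w\<close>, the inner one is \<open>z\<close>.\<close>

definition coeff_zw :: "complex fps fps \<Rightarrow> nat \<Rightarrow> nat \<Rightarrow> complex" where
  "coeff_zw F n m = fps_nth (fps_nth F m) n"

definition weighted_gf :: "mgraph set \<Rightarrow> (mgraph \<Rightarrow> complex) \<Rightarrow> complex fps fps" where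
  "weighted_gf \<F> \<omega> = Abs_fps (\<lambda>m. Abs_fps (\<lambda>n.
     \<Sum>H \<in> {H \<in> \<F>. card (verts H) = n \<and> card (edges H) = m}.
       \<omega> H / (2 ^ m * fact m * fact n)))"

definition family_gf :: "mgraph set \<Rightarrow> complex fps fps" where
  "family_gf \<F> = weighted_gf \<F> (\<lambda>_. 1)"

definition exp_z :: "complex fps fps" where
  "exp_z = fps_const (fps_exp 1)"

definition exp_cw :: "complex \<Rightarrow> complex fps fps" where
  "exp_cw c = Abs_fps (\<lambda>m. fps_const (fps_nth (fps_exp c) m))"

definition entire_zw :: "complex fps fps \<Rightarrow> bool" where
  "entire_zw F \<longleftrightarrow> (\<forall>z w. (\<lambda>(i, j). coeff_zw F i j * z ^ i * w ^ j) summable_on UNIV)"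

definition eval_zw :: "complex fps fps \<Rightarrow> complex \<Rightarrow> complex \<Rightarrow> complex" where
  "eval_zw F z w = (\<Sum>\<^sub>\<infinity>(i, j) \<in> UNIV. coeff_zw F i j * z ^ i * w ^ j)"

definition analytic_on_C2 :: "(complex \<times> complex \<Rightarrow> complex) \<Rightarrow> (complex \<times> complex) set \<Rightarrow> bool" where
  "analytic_on_C2 L S \<longleftrightarrow> (\<forall>(a, b) \<in> S. \<exists>r > 0. \<exists>c :: nat \<Rightarrow> nat \<Rightarrow> complex.
     \<forall>z w. norm (z - a) < r \<and> norm (w - b) < r \<longrightarrow>
       ((\<lambda>(i, j). c i j * (z - a) ^ i * (w - b) ^ j) has_sum L (z, w)) UNIV)"

text \<open>The eventual nonvanishing of the denominator is the well-definedness of the quotient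
  in the mathematical statement; it is explicit because division is total here.\<close>

definition rescaled_limit ::
  "complex fps fps \<Rightarrow> (nat \<Rightarrow> nat) \<Rightarrow> complex set \<Rightarrow> (complex \<times> complex \<Rightarrow> complex) \<Rightarrow> bool" where
  "rescaled_limit F m D L \<longleftrightarrow>
     (\<forall>\<^sub>F n in sequentially. eval_zw F (of_nat n) (2 * of_nat (m n) / of_nat n ^ 2) \<noteq> 0) \<and>
     (\<forall>K. compact K \<and> K \<subseteq> D \<times> D \<longrightarrow>
        uniform_limit K
          (\<lambda>n (z, w). eval_zw F (of_nat n * z) (2 * of_nat (m n) * w / of_nat n ^ 2) /
                       eval_zw F (of_nat n) (2 * of_nat (m n) / of_nat n ^ 2))
          L sequentially)"

end

theory Submission
  imports Defs "HOL-Complex_Analysis.Cauchy_Integral_Formula" "HOL-Real_Asymp.Real_Asymp"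
begin

text \<open>
  Part (i): relabeling along a bijection identifies the members of the family with \<open>k\<close> vertices and
  \<open>l\<close> edges with the copies on any prescribed \<open>k\<close> vertex labels and \<open>l\<close> edge labels, and each copy
  is completed by choosing the two ends of the \<open>m - l\<close> remaining edges. So the weighted count is the
  sum over \<open>k\<close>, \<open>l\<close> of \<open>(n choose k) (m choose l) n^(2(m - l)) W k l\<close>, with \<open>W k l\<close> the total
  weight of those members.

  Part (ii): let \<open>c k l\<close> be the coefficients of the rescaled series \<open>F(nz, 2mw/n^2) / F(n, 2m/n^2)\<close>,
  so that they sum to 1. Dividing the sum above by \<open>n^(2m) F(n, 2m/n^2)\<close> multiplies \<open>c k l\<close> by
  \<open>p n k * p m l\<close>, where \<open>p N k = N (N - 1) \<dots> (N - k + 1) / N^k\<close> satisfies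
  \<open>0 \<le> 1 - p N k \<le> k^2 / N\<close>. Uniform convergence on a polydisc of radius \<open>R > 1\<close> bounds the
  rescaled series there, so Cauchy's estimate gives \<open>\<bar>c k l\<bar> \<le> M / R^(k + l)\<close> with \<open>M\<close> independent
  of \<open>n\<close>, and the error is \<open>O(1/n + 1/m)\<close>.
\<close>

section \<open>Relabeling and isomorphism of multigraphs\<close>

definition relabel :: "(int \<Rightarrow> int) \<Rightarrow> (int \<Rightarrow> int) \<Rightarrow> mgraph \<Rightarrow> mgraph" where
  "relabel a b G = \<lparr>verts = a ` verts G, edges = map_prod a (map_prod a b) ` edges G\<rparr>"

lemma verts_relabel [simp]: "verts (relabel a b G) = a ` verts G"
  and edges_relabel [simp]: "edges (relabel a b G) = map_prod a (map_prod a b) ` edges G"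
  by (simp_all add: relabel_def)

lemma edge_label_simp [simp]: "edge_label (v, w, e) = e"
  by (simp add: edge_label_def)

lemma edge_labels_relabel: "edge_label ` edges (relabel a b G) = b ` edge_label ` edges G"
  unfolding edges_relabel image_image by (rule image_cong) auto

lemma multigraph_edge_endpoints:
  assumes "multigraph G" "(v, w, e) \<in> edges G"
  shows "v \<in> verts G" "w \<in> verts G"
  using assms by (auto simp: multigraph_def)

lemma multigraph_edge_unique:
  assumes "multigraph G" "(v, w, e) \<in> edges G" "(v', w', e) \<in> edges G"
  shows "v' = v" "w' = w"
  using assms inj_onD[of edge_label "edges G" "(v', w', e)" "(v, w, e)"]
  by (auto simp: multigraph_def)

lemma multigraph_card_labels: "multigraph G \<Longrightarrow> card (edge_label ` edges G) = card (edges G)"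
  by (simp add: multigraph_def card_image)

text \<open>Merging vertices cannot make two edge labels coincide, so injectivity is demanded of
  \<open>b\<close> alone.\<close>

lemma multigraph_relabel:
  assumes G: "multigraph G" and b: "inj_on b (edge_label ` edges G)"
  shows "multigraph (relabel a b G)"
proof -
  have "inj_on edge_label (edges (relabel a b G))"
  proof (rule inj_onI)
    fix x y assume "x \<in> edges (relabel a b G)" "y \<in> edges (relabel a b G)"
      and eq: "edge_label x = edge_label y"
    moreover from this obtain p q where "x = map_prod a (map_prod a b) p" "p \<in> edges G"
      and "y = map_prod a (map_prod a b) q" "q \<in> edges G"
      unfolding edges_relabel by (elim imageE) metis
    moreover obtain v w e v' w' e' where "p = (v, w, e)" "q = (v', w', e')"
      by (metis prod.collapse)
    ultimately have x: "x = (a v, a w, b e)" "(v, w, e) \<in> edges G"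
      and y: "y = (a v', a w', b e')" "(v', w', e') \<in> edges G"
      by simp_all
    have "e \<in> edge_label ` edges G" "e' \<in> edge_label ` edges G" using x y by (metis edge_label_simp image_eqI)+
    then have "e' = e" using inj_onD[OF b, of e' e] eq x(1) y(1) by simp
    with x y show "x = y" using multigraph_edge_unique[OF G] by blast
  qed
  with G show ?thesis by (auto simp: multigraph_def)
qed

text \<open>The witnesses are \<open>a\<close> and the map that \<open>relabel\<close> applies to
  edges. Injectivity of \<open>a\<close> ensures that an edge landing between \<open>a v\<close> and
  \<open>a w\<close> started between \<open>v\<close> and \<open>w\<close>.\<close>

lemma mg_iso_relabel:
  assumes G: "multigraph G" and a: "inj_on a (verts G)" and b: "inj_on b (edge_label ` edges G)"
  shows "mg_iso G (relabel a b G)"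
  unfolding mg_iso_def
proof (intro exI conjI ballI)
  let ?\<beta> = "map_prod a (map_prod a b)"
  show "bij_betw a (verts G) (verts (relabel a b G))"
    using a by (simp add: bij_betw_def)
  have "inj_on ?\<beta> (edges G)"
  proof (rule inj_onI)
    fix x y assume xy: "x \<in> edges G" "y \<in> edges G" and eq: "?\<beta> x = ?\<beta> y"
    obtain v w e where x: "x = (v, w, e)" by (cases x)
    obtain v' w' e' where y: "y = (v', w', e')" by (cases y)
    have "e \<in> edge_label ` edges G" "e' \<in> edge_label ` edges G" using xy x y by (metis edge_label_simp image_eqI)+
    then have "e' = e" using inj_onD[OF b, of e' e] eq x(1) y(1) by simp
    then show "x = y" using xy x y multigraph_edge_unique[OF G] by blast
  qed
  then show "bij_betw ?\<beta> (edges G) (edges (relabel a b G))"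
    by (simp add: bij_betw_def)
  fix v w assume vw: "v \<in> verts G" "w \<in> verts G"
  show "?\<beta> ` edges_between G v w = edges_between (relabel a b G) (a v) (a w)"
  proof
    show "?\<beta> ` edges_between G v w \<subseteq> edges_between (relabel a b G) (a v) (a w)"
      by (force simp: edges_between_def)
    show "edges_between (relabel a b G) (a v) (a w) \<subseteq> ?\<beta> ` edges_between G v w"
    proof
      fix x assume "x \<in> edges_between (relabel a b G) (a v) (a w)"
      then obtain v' w' e where e: "(v', w', e) \<in> edges G" "x = ?\<beta> (v', w', e)"
        and "a v' = a v" "a w' = a w"
        by (auto simp: edges_between_def)
      then have "v' = v" "w' = w"
        using a vw multigraph_edge_endpoints[OF G e(1)] by (auto dest: inj_onD)
      with e show "x \<in> ?\<beta> ` edges_between G v w"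
        by (intro image_eqI[of _ _ "(v', w', e)"]) (simp_all add: edges_between_def)
    qed
  qed
qed

lemma relabel_cancel:
  assumes G: "multigraph G"
    and a: "\<And>v. v \<in> verts G \<Longrightarrow> a' (a v) = v"
    and b: "\<And>e. e \<in> edge_label ` edges G \<Longrightarrow> b' (b e) = e"
  shows "relabel a' b' (relabel a b G) = G"
proof -
  have "(map_prod a' (map_prod a' b') \<circ> map_prod a (map_prod a b)) x = x" if "x \<in> edges G" for x
  proof (cases x)
    case (fields v w e)
    then have "e \<in> edge_label ` edges G" using that by force
    with fields that show ?thesis using a b multigraph_edge_endpoints[OF G] by auto
  qed
  then have "edges (relabel a' b' (relabel a b G)) = edges G"
    unfolding edges_relabel image_image by auto
  moreover have "verts (relabel a' b' (relabel a b G)) = verts G"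
    using a unfolding verts_relabel image_image by simp
  ultimately show ?thesis by simp
qed

lemma mg_iso_sym:
  assumes "mg_iso G H"
  shows "mg_iso H G"
proof -
  obtain \<alpha> \<beta> where \<alpha>: "bij_betw \<alpha> (verts G) (verts H)" and \<beta>: "bij_betw \<beta> (edges G) (edges H)"
    and eb: "\<And>v w. v \<in> verts G \<Longrightarrow> w \<in> verts G \<Longrightarrow>
      \<beta> ` edges_between G v w = edges_between H (\<alpha> v) (\<alpha> w)"
    using assms unfolding mg_iso_def by blast
  show ?thesis unfolding mg_iso_def
  proof (intro exI conjI ballI)
    let ?\<alpha> = "inv_into (verts G) \<alpha>" and ?\<beta> = "inv_into (edges G) \<beta>"
    show "bij_betw ?\<alpha> (verts H) (verts G)" using \<alpha> by (rule bij_betw_inv_into)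
    show "bij_betw ?\<beta> (edges H) (edges G)" using \<beta> by (rule bij_betw_inv_into)
    fix v w assume "v \<in> verts H" "w \<in> verts H"
    then obtain v' w' where v': "v' \<in> verts G" "\<alpha> v' = v" and w': "w' \<in> verts G" "\<alpha> w' = w"
      using \<alpha> unfolding bij_betw_def by (metis imageE)
    have inv: "?\<alpha> v = v'" "?\<alpha> w = w'"
      using \<alpha> v' w' by (auto intro: bij_betw_inv_into_left)
    have "edges_between G v' w' \<subseteq> edges G" by (auto simp: edges_between_def)
    then have "?\<beta> ` \<beta> ` edges_between G v' w' = edges_between G v' w'"
      using \<beta> by (intro inv_into_image_cancel) (auto simp: bij_betw_def)
    then show "?\<beta> ` edges_between H v w = edges_between G (?\<alpha> v) (?\<alpha> w)"
      using eb[of v' w'] v' w' inv by simp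
  qed
qed

lemma mg_iso_trans:
  assumes "mg_iso G H" "mg_iso H K"
  shows "mg_iso G K"
proof -
  obtain \<alpha> \<beta> where \<alpha>: "bij_betw \<alpha> (verts G) (verts H)" and \<beta>: "bij_betw \<beta> (edges G) (edges H)"
    and eb: "\<And>v w. v \<in> verts G \<Longrightarrow> w \<in> verts G \<Longrightarrow>
      \<beta> ` edges_between G v w = edges_between H (\<alpha> v) (\<alpha> w)"
    using assms(1) unfolding mg_iso_def by blast
  obtain \<alpha>' \<beta>' where \<alpha>': "bij_betw \<alpha>' (verts H) (verts K)" and \<beta>': "bij_betw \<beta>' (edges H) (edges K)"
    and eb': "\<And>v w. v \<in> verts H \<Longrightarrow> w \<in> verts H \<Longrightarrow>
      \<beta>' ` edges_between H v w = edges_between K (\<alpha>' v) (\<alpha>' w)"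
    using assms(2) unfolding mg_iso_def by blast
  show ?thesis unfolding mg_iso_def
  proof (intro exI conjI ballI)
    show "bij_betw (\<alpha>' \<circ> \<alpha>) (verts G) (verts K)" using \<alpha> \<alpha>' by (rule bij_betw_trans)
    show "bij_betw (\<beta>' \<circ> \<beta>) (edges G) (edges K)" using \<beta> \<beta>' by (rule bij_betw_trans)
    fix v w assume vw: "v \<in> verts G" "w \<in> verts G"
    then have "\<alpha> v \<in> verts H" "\<alpha> w \<in> verts H" using \<alpha> by (auto simp: bij_betw_def)
    then show "(\<beta>' \<circ> \<beta>) ` edges_between G v w = edges_between K ((\<alpha>' \<circ> \<alpha>) v) ((\<alpha>' \<circ> \<alpha>) w)"
      using eb[OF vw] eb' by (metis comp_apply image_comp)
  qed
qed

text \<open>Two members isomorphic to \<open>H\<close> are isomorphic to each other, so invariance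
  of \<omega> makes the definite description unique.\<close>

lemma copy_weight_eq:
  assumes \<omega>: "iso_invariant_weight \<F> \<omega>" and K: "K \<in> \<F>" "mg_iso H K"
  shows "copy_weight \<F> \<omega> H = \<omega> K"
  unfolding copy_weight_def
proof (rule the_equality)
  show "\<exists>K'\<in>\<F>. mg_iso H K' \<and> \<omega> K = \<omega> K'" using K by blast
  fix x assume "\<exists>K'\<in>\<F>. mg_iso H K' \<and> x = \<omega> K'"
  then obtain K' where "K' \<in> \<F>" "mg_iso H K'" "x = \<omega> K'" by blast
  then show "x = \<omega> K"
    using \<omega> K mg_iso_trans[OF mg_iso_sym] unfolding iso_invariant_weight_def by metis
qed

section \<open>Finiteness, and copies of family members on prescribed labels\<close>

lemma finite_mgraphs_within:
  assumes "finite A" "finite B"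
  shows "finite {G :: mgraph. verts G \<subseteq> A \<and> edges G \<subseteq> B}"
proof (rule finite_subset)
  show "{G :: mgraph. verts G \<subseteq> A \<and> edges G \<subseteq> B}
      \<subseteq> (\<lambda>(V, E). \<lparr>verts = V, edges = E\<rparr>) ` (Pow A \<times> Pow B)"
  proof
    fix G :: mgraph assume "G \<in> {G. verts G \<subseteq> A \<and> edges G \<subseteq> B}"
    then show "G \<in> (\<lambda>(V, E). \<lparr>verts = V, edges = E\<rparr>) ` (Pow A \<times> Pow B)"
      by (intro image_eqI[of _ _ "(verts G, edges G)"]) auto
  qed
qed (use assms in auto)

lemma multigraph_edges_subset:
  "multigraph G \<Longrightarrow> edges G \<subseteq> verts G \<times> verts G \<times> edge_label ` edges G"
  by (force simp: multigraph_def)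

lemma finite_multigraphs_within:
  assumes "finite V" "finite E"
  shows "finite {G. multigraph G \<and> verts G \<subseteq> V \<and> edge_label ` edges G \<subseteq> E}"
proof (rule finite_subset)
  show "{G. multigraph G \<and> verts G \<subseteq> V \<and> edge_label ` edges G \<subseteq> E}
      \<subseteq> {G. verts G \<subseteq> V \<and> edges G \<subseteq> V \<times> V \<times> E}"
    using multigraph_edges_subset by fast
qed (use assms in \<open>auto intro: finite_mgraphs_within\<close>)

lemma nm_multigraph_cards:
  assumes "nm_multigraph n m G"
  shows "card (verts G) = n" "card (edges G) = m"
  using assms multigraph_card_labels[of G] by (auto simp: nm_multigraph_def)

definition family_slice :: "mgraph set \<Rightarrow> nat \<Rightarrow> nat \<Rightarrow> mgraph set" where
  "family_slice \<F> k l = {H \<in> \<F>. card (verts H) = k \<and> card (edges H) = l}"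

text \<open>For a multigraph family, \<open>V = {1..int k}\<close> and \<open>E = {1..int l}\<close>
  give back \<open>family_slice \<F> k l\<close>, by closure under isomorphism.\<close>

definition family_copies :: "mgraph set \<Rightarrow> int set \<Rightarrow> int set \<Rightarrow> mgraph set" where
  "family_copies \<F> V E =
    {H. multigraph H \<and> verts H = V \<and> edge_label ` edges H = E \<and> (\<exists>K \<in> \<F>. mg_iso H K)}"

lemma family_slice_canonical:
  assumes "multigraph_family \<F>" "H \<in> family_slice \<F> k l"
  shows "nm_multigraph k l H"
  using assms nm_multigraph_cards
  unfolding multigraph_family_def family_slice_def canonical_def by blast

text \<open>The inverse relabels along the inverse bijections. It makes a copy canonical and keeps
  it isomorphic to a member, so closure under isomorphism puts the result into \<F>.\<close>

lemma relabel_family_slice_bij: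
  assumes \<F>: "multigraph_family \<F>"
    and a: "bij_betw a {1..int k} V" and b: "bij_betw b {1..int l} E"
  shows "bij_betw (relabel a b) (family_slice \<F> k l) (family_copies \<F> V E)"
proof (rule bij_betwI)
  define a' b' where "a' = inv_into {1..int k} a" and "b' = inv_into {1..int l} b"
  have a': "bij_betw a' V {1..int k}" and b': "bij_betw b' E {1..int l}"
    using a b by (simp_all add: a'_def b'_def bij_betw_inv_into)
  show "relabel a b \<in> family_slice \<F> k l \<rightarrow> family_copies \<F> V E"
  proof
    fix H assume H: "H \<in> family_slice \<F> k l"
    have "nm_multigraph k l H" by (rule family_slice_canonical[OF \<F> H])
    then have mH: "multigraph H" and inj: "inj_on a (verts H)" "inj_on b (edge_label ` edges H)"
      and "verts (relabel a b H) = V" "edge_label ` edges (relabel a b H) = E"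
      using a b unfolding nm_multigraph_def bij_betw_def
      by (auto simp: edge_labels_relabel simp del: edges_relabel)
    then show "relabel a b H \<in> family_copies \<F> V E"
      using multigraph_relabel[OF mH inj(2), of a] mg_iso_sym[OF mg_iso_relabel[OF mH inj]] H
      by (auto simp: family_copies_def family_slice_def simp del: edges_relabel)
  qed
  show "relabel a' b' \<in> family_copies \<F> V E \<rightarrow> family_slice \<F> k l"
  proof
    fix H assume H: "H \<in> family_copies \<F> V E"
    then have mH: "multigraph H" and vH: "verts H = V" and eH: "edge_label ` edges H = E"
      by (auto simp: family_copies_def)
    obtain K where K: "K \<in> \<F>" "mg_iso H K" using H by (auto simp: family_copies_def)
    have inj: "inj_on a' (verts H)" "inj_on b' (edge_label ` edges H)"
      using a' b' vH eH by (auto simp: bij_betw_def)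
    have "nm_multigraph k l (relabel a' b' H)"
      using multigraph_relabel[OF mH inj(2)] a' b' vH eH
      by (simp add: nm_multigraph_def edge_labels_relabel bij_betw_def del: edges_relabel)
    moreover have "mg_iso K (relabel a' b' H)"
      using mg_iso_trans[OF mg_iso_sym[OF K(2)] mg_iso_relabel[OF mH inj]] .
    ultimately show "relabel a' b' H \<in> family_slice \<F> k l"
      using \<F> K(1) nm_multigraph_cards
      unfolding multigraph_family_def family_slice_def canonical_def by blast
  qed
  show "relabel a' b' (relabel a b H) = H" if "H \<in> family_slice \<F> k l" for H
    using family_slice_canonical[OF \<F> that] bij_betw_inv_into_left[OF a] bij_betw_inv_into_left[OF b]
    by (intro relabel_cancel) (auto simp: nm_multigraph_def a'_def b'_def)
  show "relabel a b (relabel a' b' H) = H" if "H \<in> family_copies \<F> V E" for H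
    using that bij_betw_inv_into_right[OF a] bij_betw_inv_into_right[OF b]
    by (intro relabel_cancel) (auto simp: family_copies_def a'_def b'_def)
qed

text \<open>Relabeling preserves the isomorphism class and hence the weight. Only the sizes of
  \<open>V\<close> and \<open>E\<close> survive, which is what later produces binomial
  coefficients.\<close>

lemma sum_copy_weight_family_copies:
  assumes \<F>: "multigraph_family \<F>" and \<omega>: "iso_invariant_weight \<F> \<omega>"
    and "finite V" "finite E"
  shows "(\<Sum>H\<in>family_copies \<F> V E. copy_weight \<F> \<omega> H)
    = (\<Sum>K\<in>family_slice \<F> (card V) (card E). \<omega> K)"
proof -
  obtain a b where a: "bij_betw a {1..int (card V)} V" and b: "bij_betw b {1..int (card E)} E"
    using finite_same_card_bij assms(3,4) by (metis card_atLeastAtMost_int diff_add_cancel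
        finite_atLeastAtMost_int nat_int)
  have "copy_weight \<F> \<omega> (relabel a b K) = \<omega> K"
    if K: "K \<in> family_slice \<F> (card V) (card E)" for K
  proof (rule copy_weight_eq[OF \<omega>])
    show "K \<in> \<F>" using K by (simp add: family_slice_def)
    show "mg_iso (relabel a b K) K"
      using family_slice_canonical[OF \<F> K] a b
      by (intro mg_iso_sym[OF mg_iso_relabel]) (simp_all add: nm_multigraph_def bij_betw_def)
  qed
  then show ?thesis
    using sum.reindex_bij_betw[OF relabel_family_slice_bij[OF \<F> a b], of "copy_weight \<F> \<omega>"]
    by simp
qed

section \<open>Completing a copy, and the count as a finite sum\<close>

definition completions :: "nat \<Rightarrow> nat \<Rightarrow> mgraph \<Rightarrow> mgraph set" where
  "completions n m H = {G. nm_multigraph n m G \<and> subgraph H G}"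

text \<open>Once \<open>H\<close> is fixed, each label in \<open>I\<close> receives an ordered pair
  of ends independently of the others; \<open>f\<close> records these pairs. Extensional functions
  keep values outside \<open>I\<close> from being counted.\<close>

lemma completions_bij:
  assumes H: "multigraph H" "verts H \<subseteq> {1..int n}" "edge_label ` edges H \<subseteq> {1..int m}"
  defines "I \<equiv> {1..int m} - edge_label ` edges H"
  shows "bij_betw (\<lambda>f. \<lparr>verts = {1..int n}, edges = edges H \<union> (\<lambda>e. (fst (f e), snd (f e), e)) ` I\<rparr>)
    (I \<rightarrow>\<^sub>E {1..int n} \<times> {1..int n}) (completions n m H)"
    (is "bij_betw ?\<Phi> ?P _")
  unfolding bij_betw_def
proof
  \<comment> \<open>Labels in \<open>I\<close> are new to \<open>H\<close>, so an added edge is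
    never confused with an edge of \<open>H\<close>.\<close>
  have lab: "(v, w, e) \<notin> edges H" if "e \<in> I" for v w e
    using that by (force simp: I_def)
  show "inj_on ?\<Phi> ?P"
  proof (rule inj_onI)
    fix f g assume fg: "f \<in> ?P" "g \<in> ?P" and eq: "?\<Phi> f = ?\<Phi> g"
    show "f = g"
    proof (rule PiE_ext[OF fg])
      fix e assume e: "e \<in> I"
      have "(fst (f e), snd (f e), e) \<in> edges (?\<Phi> g)"
        unfolding eq[symmetric] using e by auto
      then show "f e = g e" using lab[OF e] by (auto simp: prod_eq_iff)
    qed
  qed
  show "?\<Phi> ` ?P = completions n m H"
  proof
    show "?\<Phi> ` ?P \<subseteq> completions n m H"
    proof safe
      fix f assume f: "f \<in> ?P"
      let ?G = "?\<Phi> f"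
      have "inj_on edge_label (edges ?G)"
        using H(1) lab unfolding multigraph_def by (force simp: inj_on_def)
      moreover have "finite (edges ?G)" using H(1) by (auto simp: multigraph_def I_def)
      moreover have "\<forall>(v, w, e) \<in> edges ?G. v \<in> verts ?G \<and> w \<in> verts ?G"
        using f H(2) multigraph_edge_endpoints[OF H(1)] by (fastforce simp: PiE_def Pi_def)
      moreover have "edge_label ` edges ?G = {1..int m}"
        using H(3) by (force simp: image_Un image_image I_def)
      ultimately show "?G \<in> completions n m H"
        using H(1,2) by (simp add: completions_def nm_multigraph_def multigraph_def subgraph_def)
    qed
    show "completions n m H \<subseteq> ?\<Phi> ` ?P"
    proof
      fix G assume "G \<in> completions n m H"
      then have G: "multigraph G" "verts G = {1..int n}" "edge_label ` edges G = {1..int m}"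
        and HG: "edges H \<subseteq> edges G"
        by (auto simp: completions_def nm_multigraph_def subgraph_def)
      have "\<exists>p. (fst p, snd p, e) \<in> edges G" if "e \<in> I" for e
      proof -
        have "e \<in> edge_label ` edges G" using that G(3) by (simp add: I_def)
        then show ?thesis by force
      qed
      then obtain f0 where f0: "\<And>e. e \<in> I \<Longrightarrow> (fst (f0 e), snd (f0 e), e) \<in> edges G"
        by metis
      define f where "f = restrict f0 I"
      have f: "(fst (f e), snd (f e), e) \<in> edges G" if "e \<in> I" for e
        using f0 that by (simp add: f_def)
      have fP: "f \<in> ?P"
      proof (rule PiE_I)
        fix e assume "e \<in> I"
        then show "f e \<in> {1..int n} \<times> {1..int n}"
          using multigraph_edge_endpoints[OF G(1) f] G(2) by (simp add: mem_Times_iff)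
      qed (simp add: f_def)
      have "edges G \<subseteq> edges (?\<Phi> f)"
      proof
        fix x assume x: "x \<in> edges G"
        obtain v w e where xe: "x = (v, w, e)" by (cases x)
        show "x \<in> edges (?\<Phi> f)"
        proof (cases "e \<in> edge_label ` edges H")
          \<comment> \<open>\<open>H\<close> has an edge with this label, and it lies in
            \<open>G\<close>; uniqueness of labels in \<open>G\<close> forces it to be
            \<open>x\<close>.\<close>
          case True
          then obtain v' w' where "(v', w', e) \<in> edges H" by force
          moreover from this have "(v', w', e) \<in> edges G" using HG by blast
          ultimately show ?thesis using multigraph_edge_unique[OF G(1), of v w e v' w'] x xe by simp
        next
          case False
          then have e: "e \<in> I" using x xe G(3) by (force simp: I_def)
          then have "fst (f e) = v" "snd (f e) = w"
            using multigraph_edge_unique[OF G(1) _ f[OF e]] x xe by blast+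
          then have "x = (fst (f e), snd (f e), e)" using xe by simp
          then show ?thesis using e by simp
        qed
      qed
      then have "edges (?\<Phi> f) = edges G" using f HG by auto
      then have "G = ?\<Phi> f" using G(2) by simp
      then show "G \<in> ?\<Phi> ` ?P" using fP by blast
    qed
  qed
qed

lemma card_completions:
  assumes "multigraph H" "verts H \<subseteq> {1..int n}" "edge_label ` edges H \<subseteq> {1..int m}"
  shows "card (completions n m H) = n ^ (2 * (m - card (edges H)))"
proof -
  have "card (completions n m H)
      = card (({1..int m} - edge_label ` edges H) \<rightarrow>\<^sub>E {1..int n} \<times> {1..int n})"
    using bij_betw_same_card[OF completions_bij[OF assms]] by simp
  also have "\<dots> = (n * n) ^ card ({1..int m} - edge_label ` edges H)"
    by (simp add: card_PiE card_cartesian_product)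
  also have "card ({1..int m} - edge_label ` edges H) = m - card (edges H)"
    using assms multigraph_card_labels by (subst card_Diff_subset) (auto intro: finite_subset)
  finally show ?thesis by (simp add: power_mult power2_eq_square)
qed

lemma sum_Pow_card:
  fixes g :: "nat \<Rightarrow> 'a::comm_semiring_1"
  assumes A: "finite A"
  shows "(\<Sum>X\<in>Pow A. g (card X)) = (\<Sum>k\<le>card A. of_nat (card A choose k) * g k)"
proof -
  have "(\<Sum>X\<in>Pow A. g (card X)) = (\<Sum>k\<le>card A. \<Sum>X\<in>{X \<in> Pow A. card X = k}. g (card X))"
    using A by (intro sum.group [symmetric]) (auto intro: card_mono)
  also have "\<dots> = (\<Sum>k\<le>card A. of_nat (card A choose k) * g k)"
    using n_subsets[OF A] by (intro sum.cong refl) simp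
  finally show ?thesis .
qed

text \<open>The sum over pairs is taken over the copy first, because the number of completions
  depends only on the number of edges of the copy. Grouping copies by their label sets then leaves a
  function of two cardinalities.\<close>

lemma weighted_MG_eq_sum:
  assumes \<F>: "multigraph_family \<F>" and \<omega>: "iso_invariant_weight \<F> \<omega>"
  shows "weighted_MG \<F> \<omega> n m = (\<Sum>k\<le>n. \<Sum>l\<le>m.
    of_nat (n choose k) * of_nat (m choose l) * of_nat n ^ (2 * (m - l)) * sum \<omega> (family_slice \<F> k l))"
proof -
  let ?N = "{1..int n}" and ?M = "{1..int m}"
  \<comment> \<open>\<open>S\<close> collects the possible copies without reference to
    \<open>G\<close>, so that the order of summation can be exchanged.\<close>
  define S where "S = {H. multigraph H \<and> verts H \<subseteq> ?N \<and> edge_label ` edges H \<subseteq> ?M \<and>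
    (\<exists>K\<in>\<F>. mg_iso H K)}"
  have finS: "finite S"
    by (rule finite_subset[OF _ finite_multigraphs_within[of ?N ?M]]) (auto simp: S_def)
  have "finite (completions n m H)" for H
    by (rule finite_subset[OF _ finite_multigraphs_within[of ?N ?M]])
      (auto simp: completions_def nm_multigraph_def)
  note fin = finS this
  have "(G, H) \<in> MG_pairs \<F> n m \<longleftrightarrow> (H, G) \<in> Sigma S (completions n m)" for G H
    using image_mono[of "edges H" "edges G" edge_label]
    by (auto simp: MG_pairs_def S_def completions_def family_subgraph_def subgraph_def nm_multigraph_def)
  then have pairs: "MG_pairs \<F> n m = prod.swap ` Sigma S (completions n m)"
    by (auto simp: image_iff)
  have "weighted_MG \<F> \<omega> n m = (\<Sum>(H, G)\<in>Sigma S (completions n m). copy_weight \<F> \<omega> H)"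
    unfolding weighted_MG_def pairs by (subst sum.reindex) (auto simp: inj_on_def case_prod_beta)
  also have "\<dots> = (\<Sum>H\<in>S. \<Sum>G\<in>completions n m H. copy_weight \<F> \<omega> H)"
    using fin by (intro sum.Sigma [symmetric]) auto
  also have "\<dots> = (\<Sum>H\<in>S. of_nat n ^ (2 * (m - card (edges H))) * copy_weight \<F> \<omega> H)"
    by (intro sum.cong refl) (simp add: S_def card_completions)
  also have "\<dots> = (\<Sum>p\<in>Pow ?N \<times> Pow ?M. \<Sum>H\<in>{H \<in> S. (verts H, edge_label ` edges H) = p}.
      of_nat n ^ (2 * (m - card (edges H))) * copy_weight \<F> \<omega> H)"
    using finS by (intro sum.group [symmetric]) (auto simp: S_def)
  also have "\<dots> = (\<Sum>(V, E)\<in>Pow ?N \<times> Pow ?M.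
      of_nat n ^ (2 * (m - card E)) * sum \<omega> (family_slice \<F> (card V) (card E)))"
  proof (intro sum.cong refl, clarify)
    fix V E assume V: "V \<subseteq> ?N" and E: "E \<subseteq> ?M"
    have "{H \<in> S. (verts H, edge_label ` edges H) = (V, E)} = family_copies \<F> V E"
      using V E by (auto simp: S_def family_copies_def)
    then have "(\<Sum>H\<in>{H \<in> S. (verts H, edge_label ` edges H) = (V, E)}.
        of_nat n ^ (2 * (m - card (edges H))) * copy_weight \<F> \<omega> H)
      = (\<Sum>H\<in>family_copies \<F> V E. of_nat n ^ (2 * (m - card E)) * copy_weight \<F> \<omega> H)"
      using multigraph_card_labels by (intro sum.cong) (auto simp: family_copies_def)
    also have "\<dots> = of_nat n ^ (2 * (m - card E)) * sum \<omega> (family_slice \<F> (card V) (card E))"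
      using sum_copy_weight_family_copies[OF \<F> \<omega>, of V E] V E
      by (simp add: sum_distrib_left [symmetric] finite_subset)
    finally show "(\<Sum>H\<in>{H \<in> S. (verts H, edge_label ` edges H) = (V, E)}.
        of_nat n ^ (2 * (m - card (edges H))) * copy_weight \<F> \<omega> H)
      = of_nat n ^ (2 * (m - card E)) * sum \<omega> (family_slice \<F> (card V) (card E))" .
  qed
  also have "\<dots> = (\<Sum>V\<in>Pow ?N. \<Sum>E\<in>Pow ?M.
      of_nat n ^ (2 * (m - card E)) * sum \<omega> (family_slice \<F> (card V) (card E)))"
    by (rule sum.cartesian_product [symmetric])
  \<comment> \<open>The summand sees first \<open>E\<close>, then \<open>V\<close>, only through its
    size, so subsets of equal size merge into a binomial coefficient.\<close>
  also have "\<dots> = (\<Sum>V\<in>Pow ?N. \<Sum>l\<le>m. of_nat (m choose l) *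
      (of_nat n ^ (2 * (m - l)) * sum \<omega> (family_slice \<F> (card V) l)))"
    by (subst sum_Pow_card) simp_all
  also have "\<dots> = (\<Sum>k\<le>n. of_nat (n choose k) * (\<Sum>l\<le>m. of_nat (m choose l) *
      (of_nat n ^ (2 * (m - l)) * sum \<omega> (family_slice \<F> k l))))"
    by (subst sum_Pow_card) simp_all
  finally show ?thesis by (simp add: sum_distrib_left mult.assoc)
qed

section \<open>Coefficient extraction from the generating function\<close>

lemma coeff_weighted_gf:
  "coeff_zw (weighted_gf \<F> \<omega>) k l = sum \<omega> (family_slice \<F> k l) / (2 ^ l * fact l * fact k)"
  by (simp add: coeff_zw_def weighted_gf_def family_slice_def sum_divide_distrib)

text \<open>\<open>exp_z\<close> is free of \<open>w\<close> and \<open>exp_cw\<close> is free of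
  \<open>z\<close>, so each product is a convolution in one variable. The outer variable
  \<open>w\<close> puts the sum over \<open>l\<close> outside, hence the exchange at the
  end.\<close>

lemma coeff_mult_exp_exp:
  "coeff_zw (F * exp_z * exp_cw c) n m
    = (\<Sum>k\<le>n. \<Sum>l\<le>m. coeff_zw F k l / fact (n - k) * (c ^ (m - l) / fact (m - l)))"
proof -
  have "coeff_zw (F * exp_z * exp_cw c) n m
      = (\<Sum>l\<le>m. \<Sum>k\<le>n. coeff_zw F k l / fact (n - k) * (c ^ (m - l) / fact (m - l)))"
    by (simp add: coeff_zw_def exp_z_def exp_cw_def fps_mult_nth[of _ _ m] fps_sum_nth atMost_atLeast0
        fps_mult_nth[of _ _ n] sum_distrib_right mult.assoc)
  then show ?thesis by (subst sum.swap)
qed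

lemma weighted_MG_eq_coeff:
  assumes \<F>: "multigraph_family \<F>" and \<omega>: "iso_invariant_weight \<F> \<omega>"
  shows "weighted_MG \<F> \<omega> n m = fact n * 2 ^ m * fact m *
    coeff_zw (weighted_gf \<F> \<omega> * exp_z * exp_cw (of_nat n ^ 2 / 2)) n m"
proof -
  \<comment> \<open>The sums agree term by term: binomial coefficients expand into factorials, and
    \<open>n^(2(m - l))\<close> is \<open>2^(m - l)\<close> times the power of
    \<open>n^2/2\<close>.\<close>
  have "of_nat (n choose k) * of_nat (m choose l) * of_nat n ^ (2 * (m - l)) * W
      = fact n * 2 ^ m * fact m * (W / (2 ^ l * fact l * fact k) / fact (n - k) *
          ((of_nat n ^ 2 / 2) ^ (m - l) / fact (m - l)))"
    if "k \<le> n" "l \<le> m" for k l and W :: complex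
  proof -
    have "(2::complex) ^ m = 2 ^ l * 2 ^ (m - l)"
      using that by (simp flip: power_add)
    then show ?thesis
      using that by (simp add: binomial_fact power_divide mult_ac flip: power_mult)
  qed
  moreover have "c * (\<Sum>k\<le>n. \<Sum>l\<le>m. g k l) = (\<Sum>k\<le>n. \<Sum>l\<le>m. c * g k l)"
    for c and g :: "nat \<Rightarrow> nat \<Rightarrow> complex"
    by (simp add: sum_distrib_left)
  ultimately show ?thesis
    unfolding weighted_MG_eq_sum[OF assms] coeff_mult_exp_exp
    by (simp only:, intro sum.cong refl, simp only: coeff_weighted_gf atMost_iff)
qed

text \<open>Every copy inherits the constant weight 1, so the unweighted claims are instances of the
  weighted ones.\<close>

lemma of_nat_MG_eq_weighted_MG: "of_nat (MG \<F> n m) = weighted_MG \<F> (\<lambda>_. 1) n m"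
proof -
  have "copy_weight \<F> (\<lambda>_. 1) H = 1" if "(G, H) \<in> MG_pairs \<F> n m" for G H
    using that copy_weight_eq[of \<F> "\<lambda>_. 1"]
    by (force simp: MG_pairs_def family_subgraph_def iso_invariant_weight_def)
  then have "weighted_MG \<F> (\<lambda>_. 1) n m = (\<Sum>_\<in>MG_pairs \<F> n m. 1)"
    unfolding weighted_MG_def by (intro sum.cong) auto
  then show ?thesis by (simp add: MG_def)
qed

section \<open>Cauchy estimates in one and two variables\<close>

text \<open>Summability at every \<open>z\<close> means an infinite radius of convergence, so the
  sum is entire and Cauchy's inequality on the circle of radius \<open>R\<close> bounds its
  derivatives at 0.\<close>

lemma power_series_coeff_bound:
  fixes c :: "nat \<Rightarrow> complex"
  assumes R: "R > 0" and summ: "\<And>z. (\<lambda>n. c n * z ^ n) summable_on UNIV"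
    and bound: "\<And>z. norm z = R \<Longrightarrow> norm (\<Sum>\<^sub>\<infinity>n. c n * z ^ n) \<le> M"
  shows "norm (c n) * R ^ n \<le> M"
proof -
  define f where "f = Abs_fps c"
  have conv: "fps_conv_radius f = \<infinity>"
    unfolding fps_conv_radius_def f_def
    using summ by (intro conv_radius_inftyI'' summable_on_imp_summable) simp
  have eval: "eval_fps f z = (\<Sum>\<^sub>\<infinity>n. c n * z ^ n)" for z
  proof -
    have "(\<lambda>n. c n * z ^ n) sums (\<Sum>\<^sub>\<infinity>n. c n * z ^ n)"
      using summ by (intro has_sum_imp_sums has_sum_infsum)
    then show ?thesis by (simp add: eval_fps_def f_def sums_iff)
  qed
  have hol: "eval_fps f holomorphic_on A" for A
    using conv by (intro holomorphic_on_eval_fps) auto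
  have "norm ((deriv ^^ n) (eval_fps f) 0) \<le> fact n * M / R ^ n"
    using R bound by (intro Cauchy_inequality hol holomorphic_on_imp_continuous_on) (auto simp: eval)
  moreover have "c n = (deriv ^^ n) (eval_fps f) 0 / fact n"
    using fps_nth_conv_deriv[of f n] conv by (simp add: f_def)
  ultimately have "norm (c n) \<le> fact n * M / R ^ n / fact n"
    by (simp only: norm_divide norm_fact) (rule divide_right_mono, simp_all)
  then show ?thesis using R by (simp add: field_simps)
qed

text \<open>The one-variable estimate is used twice: in \<open>w\<close> with \<open>z\<close> fixed
  on the circle, where the coefficients are power series in \<open>z\<close>, and then in
  \<open>z\<close> for each of those.\<close>

lemma double_power_series_coeff_bound:
  fixes c :: "nat \<Rightarrow> nat \<Rightarrow> complex"
  assumes R: "R > 0" and summ: "\<And>z w. (\<lambda>(i, j). c i j * z ^ i * w ^ j) summable_on UNIV"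
    and bound: "\<And>z w. norm z = R \<Longrightarrow> norm w = R \<Longrightarrow>
      norm (\<Sum>\<^sub>\<infinity>(i, j). c i j * z ^ i * w ^ j) \<le> M"
  shows "norm (c i j) * R ^ i * R ^ j \<le> M"
proof -
  have summ': "(\<lambda>(j, i). c i j * z ^ i * w ^ j) summable_on UNIV \<times> UNIV" for z w
    using summ[of z w] by (subst summable_on_swap) simp
  \<comment> \<open>Setting \<open>w = 1\<close> removes the power of \<open>w\<close> from the
    slice with index \<open>j\<close>.\<close>
  have inner: "(\<lambda>i. c i j * z ^ i) summable_on UNIV" for z j
    using summable_on_SigmaD1[OF summ'[of z 1], of j] by simp
  have eq: "(\<Sum>\<^sub>\<infinity>(i, j). c i j * z ^ i * w ^ j) = (\<Sum>\<^sub>\<infinity>j. (\<Sum>\<^sub>\<infinity>i. c i j * z ^ i) * w ^ j)"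
    and outer: "(\<lambda>j. (\<Sum>\<^sub>\<infinity>i. c i j * z ^ i) * w ^ j) summable_on UNIV" for z w
  proof -
    have "(\<Sum>\<^sub>\<infinity>(i, j). c i j * z ^ i * w ^ j) = (\<Sum>\<^sub>\<infinity>i. \<Sum>\<^sub>\<infinity>j. c i j * z ^ i * w ^ j)"
      using infsum_Sigma'_banach[of "\<lambda>i j. c i j * z ^ i * w ^ j" UNIV "\<lambda>_. UNIV"] summ[of z w]
      by simp
    also have "\<dots> = (\<Sum>\<^sub>\<infinity>j. \<Sum>\<^sub>\<infinity>i. c i j * z ^ i * w ^ j)"
      using summ[of z w] by (intro infsum_swap_banach) simp
    also have "\<dots> = (\<Sum>\<^sub>\<infinity>j. (\<Sum>\<^sub>\<infinity>i. c i j * z ^ i) * w ^ j)"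
      using inner by (simp add: infsum_cmult_left)
    finally show "(\<Sum>\<^sub>\<infinity>(i, j). c i j * z ^ i * w ^ j) = (\<Sum>\<^sub>\<infinity>j. (\<Sum>\<^sub>\<infinity>i. c i j * z ^ i) * w ^ j)" .
    have "(\<lambda>j. \<Sum>\<^sub>\<infinity>i. c i j * z ^ i * w ^ j) summable_on UNIV"
      using summable_on_Sigma_banach[OF summ'[of z w]] by simp
    then show "(\<lambda>j. (\<Sum>\<^sub>\<infinity>i. c i j * z ^ i) * w ^ j) summable_on UNIV"
      using inner by (simp add: infsum_cmult_left)
  qed
  have "norm (\<Sum>\<^sub>\<infinity>i. c i j * z ^ i) * R ^ j \<le> M" if z: "norm z = R" for z
    by (rule power_series_coeff_bound[OF R outer]) (use bound[OF z] in \<open>simp add: eq\<close>)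
  \<comment> \<open>For fixed \<open>j\<close> the first estimate bounds the series in
    \<open>z\<close> by \<open>M / R ^ j\<close> on the whole circle.\<close>
  then have "norm (c i j) * R ^ i \<le> M / R ^ j"
    using R by (intro power_series_coeff_bound[OF R inner]) (simp add: field_simps)
  then show ?thesis using R by (simp add: field_simps)
qed

section \<open>Falling factorials, dominating sums and a larger polydisc\<close>

text \<open>\<open>p\<close> is the product of \<open>1 - i/N\<close> over \<open>i < k\<close>.
  Passing from \<open>k\<close> to \<open>k + 1\<close> lowers it by at most \<open>k/N\<close>, and
  \<open>k^2 + k \<le> (k + 1)^2\<close> keeps the quadratic bound.\<close>

lemma falling_ratio_bounds:
  fixes N k :: nat
  assumes N: "N > 0"
  defines "p \<equiv> real (N choose k) * fact k / real N ^ k"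
  shows "0 \<le> p" "p \<le> 1" "1 - p \<le> real k ^ 2 / real N"
proof -
  define q where "q k = real (N choose k) * fact k / real N ^ k" for k
  \<comment> \<open>For \<open>k > N\<close> the new factor is negative, but both binomial
    coefficients vanish.\<close>
  have q_Suc: "q (Suc k) = q k * ((real N - real k) / real N)" for k
  proof (cases "k \<le> N")
    case True
    have "real (N choose Suc k) * real (Suc k) = real (N choose k) * (real N - real k)"
      using True binomial_absorb_comp[of N k] binomial_absorption[of k N]
      by (metis mult.commute of_nat_diff of_nat_mult)
    then have "real (N choose Suc k) * fact (Suc k) = real (N choose k) * fact k * (real N - real k)"
      by (simp add: mult_ac)
    then show ?thesis by (simp only: q_def power_Suc times_divide_times_eq mult.commute)
  qed (simp add: q_def binomial_eq_0)
  have "0 \<le> q k \<and> q k \<le> 1 \<and> 1 - q k \<le> real k ^ 2 / real N"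
  proof (induction k)
    case 0
    then show ?case by (simp add: q_def)
  next
    case (Suc k)
    have sq: "real k ^ 2 / real N + real k / real N \<le> real (Suc k) ^ 2 / real N"
      using N by (simp add: power2_eq_square field_simps)
    show ?case
    proof (cases "k \<le> N")
      case True
      define t where "t = real k / real N"
      have t: "0 \<le> t" "t \<le> 1" using True N by (auto simp: t_def)
      have "q (Suc k) = q k * (1 - t)" using N by (simp add: q_Suc t_def diff_divide_distrib)
      moreover have "q k * t \<le> t" using Suc t by (simp add: mult_left_le_one_le)
      moreover have "q k * (1 - t) \<le> 1" "0 \<le> q k * (1 - t)" using Suc t by (simp_all add: mult_le_one)
      ultimately show ?thesis using Suc sq unfolding t_def by (simp add: right_diff_distrib)
    next
      \<comment> \<open>Past \<open>N\<close> the ratio is 0 and the claimed bound is at least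
        1.\<close>
      case False
      then have "q (Suc k) = 0" by (simp add: q_def)
      moreover have "real N \<le> real (Suc k) ^ 2"
        using False by (simp add: power2_eq_square flip: of_nat_mult of_nat_Suc)
      ultimately show ?thesis using N by simp
    qed
  qed
  then show "0 \<le> p" "p \<le> 1" "1 - p \<le> real k ^ 2 / real N"
    by (auto simp: p_def q_def)
qed

lemma summable_on_square_geometric:
  fixes r :: real
  assumes "0 < r" "r < 1"
  shows "(\<lambda>k. (real k ^ 2 + 1) * r ^ k) summable_on (UNIV :: nat set)"
proof -
  have "summable (\<lambda>k. (real k ^ 2 + 1) * r ^ k)"
  proof (rule summable_comparison_test_bigo)
    \<comment> \<open>Any ratio strictly between \<open>r\<close> and 1 absorbs the quadratic
      factor; the midpoint is taken.\<close>
    show "(\<lambda>k. (real k ^ 2 + 1) * r ^ k) \<in> O(\<lambda>k. ((1 + r) / 2) ^ k)"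
      using assms by real_asymp
    show "summable (\<lambda>k. norm (((1 + r) / 2) ^ k))"
      using assms by (simp add: summable_geometric)
  qed
  then show ?thesis
    using assms by (intro summable_nonneg_imp_summable_on) auto
qed

lemma summable_on_product_nonneg:
  fixes f g :: "'a \<Rightarrow> real"
  assumes "f summable_on A" "g summable_on B"
    and "\<And>x. x \<in> A \<Longrightarrow> 0 \<le> f x" "\<And>y. y \<in> B \<Longrightarrow> 0 \<le> g y"
  shows "(\<lambda>(x, y). f x * g y) summable_on A \<times> B"
proof (rule summable_on_SigmaI)
  show "((\<lambda>y. case (x, y) of (x, y) \<Rightarrow> f x * g y) has_sum f x * infsum g B) B" for x
    using assms(2) by (auto intro!: has_sum_cmult_right has_sum_infsum)
  show "(\<lambda>x. f x * infsum g B) summable_on A"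
    using assms(1) by (rule summable_on_cmult_left)
qed (use assms in auto)

text \<open>Compactness gives the closed unit ball a uniform margin \<open>e\<close> inside
  \<open>D\<close>. A point of norm between 1 and \<open>1 + e/2\<close> lies within
  \<open>e\<close> of its radial projection \<open>sgn x\<close>.\<close>

lemma open_supset_unit_cball_obtain_radius:
  fixes D :: "'a::euclidean_space set"
  assumes "open D" "cball 0 1 \<subseteq> D"
  obtains R :: real where "R > 1" "cball 0 R \<subseteq> D"
proof -
  obtain e where e: "e > 0" "(\<Union>x\<in>cball (0::'a) 1. ball x e) \<subseteq> D"
    using compact_subset_open_imp_ball_epsilon_subset[OF compact_cball assms] by blast
  have "cball (0::'a) (1 + e / 2) \<subseteq> D"
  proof
    fix x :: 'a assume x: "x \<in> cball 0 (1 + e / 2)"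
    show "x \<in> D"
    proof (cases "norm x \<le> 1")
      case True
      then show ?thesis using assms by auto
    next
      case False
      have "dist (sgn x) x = norm ((1 / norm x - 1) *\<^sub>R x)"
        by (simp add: dist_norm sgn_div_norm scaleR_diff_left divide_inverse)
      also have "\<dots> = norm x - 1"
        unfolding norm_scaleR using False by (cases "x = 0") (simp_all add: abs_if field_simps)
      also have "\<dots> < e" using x e by simp
      finally have "x \<in> ball (sgn x) e" by simp
      moreover have "sgn x \<in> cball 0 1" by (simp add: norm_sgn)
      ultimately show ?thesis using e by blast
    qed
  qed
  with e that[of "1 + e / 2"] show thesis by simp
qed

section \<open>The rescaled series and the asymptotics\<close>

text \<open>Two quotients within 1 of \<open>L\<close> on the polydisc differ by less than 2 there.
  Hence a bound for a single one bounds all sufficiently late ones, and the double Cauchy estimate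
  passes this on to the coefficients.\<close>

lemma rescaled_coeff_bound:
  fixes F :: "complex fps fps" and m :: "nat \<Rightarrow> nat"
  assumes entire: "entire_zw F" and R: "R > 0" "cball 0 R \<subseteq> D"
    and lim: "rescaled_limit F m D L"
  defines "A \<equiv> \<lambda>n. eval_zw F (of_nat n) (2 * of_nat (m n) / of_nat n ^ 2)"
  obtains M where "\<forall>\<^sub>F n in sequentially. \<forall>i j.
    norm (coeff_zw F i j * of_nat n ^ i * (2 * of_nat (m n) / of_nat n ^ 2) ^ j / A n)
      \<le> M * (1 / R) ^ i * (1 / R) ^ j"
proof -
  define c where "c n i j = coeff_zw F i j * of_nat n ^ i * (2 * of_nat (m n) / of_nat n ^ 2) ^ j / A n"
    for n i j
  define Q where "Q n z w = eval_zw F (of_nat n * z) (2 * of_nat (m n) * w / of_nat n ^ 2) / A n"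
    for n z w
  have term_eq: "c n i j * z ^ i * w ^ j =
      coeff_zw F i j * (of_nat n * z) ^ i * (2 * of_nat (m n) * w / of_nat n ^ 2) ^ j / A n"
    for n i j z w
    by (simp add: c_def power_mult_distrib power_divide)
  \<comment> \<open>This covers \<open>A n = 0\<close> too: both sides are then 0 by the convention
    for division.\<close>
  have has_sum: "((\<lambda>(i, j). c n i j * z ^ i * w ^ j) has_sum Q n z w) UNIV" for n z w
  proof -
    have "((\<lambda>(i, j). coeff_zw F i j * (of_nat n * z) ^ i * (2 * of_nat (m n) * w / of_nat n ^ 2) ^ j)
        has_sum eval_zw F (of_nat n * z) (2 * of_nat (m n) * w / of_nat n ^ 2)) UNIV"
      using entire unfolding entire_zw_def eval_zw_def by (intro has_sum_infsum) blast
    from has_sum_divide_const[OF this, of "A n"] show ?thesis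
      by (simp add: Q_def term_eq case_prod_unfold)
  qed
  let ?K = "cball (0::complex) R \<times> cball (0::complex) R"
  have "\<forall>K. compact K \<and> K \<subseteq> D \<times> D \<longrightarrow> uniform_limit K (\<lambda>n (z, w). Q n z w) L sequentially"
    using lim unfolding rescaled_limit_def Q_def A_def by (rule conjunct2)
  moreover have "compact ?K" by (intro compact_Times compact_cball)
  moreover have "?K \<subseteq> D \<times> D" using R(2) by auto
  ultimately have "uniform_limit ?K (\<lambda>n (z, w). Q n z w) L sequentially" by blast
  then have ev: "\<forall>\<^sub>F n in sequentially. \<forall>x\<in>?K. dist (case x of (z, w) \<Rightarrow> Q n z w) (L x) < 1"
    by (rule uniform_limitD) simp
  then obtain N where N: "\<And>x. x \<in> ?K \<Longrightarrow> dist (case x of (z, w) \<Rightarrow> Q N z w) (L x) < 1"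
    by (auto simp: eventually_sequentially)
  \<comment> \<open>The absolute sum at the corner \<open>(R, R)\<close> dominates the reference
    series throughout the polydisc.\<close>
  define B where "B = (\<Sum>\<^sub>\<infinity>(i, j). norm (c N i j * of_real R ^ i * of_real R ^ j))"
  have QN: "norm (Q N z w) \<le> B" if "norm z \<le> R" "norm w \<le> R" for z w
  proof (rule norm_infsum_le[OF has_sum])
    have "(\<lambda>x. norm (case x of (i, j) \<Rightarrow> c N i j * of_real R ^ i * of_real R ^ j)) summable_on UNIV"
      using has_sum_imp_summable[OF has_sum[of N "of_real R" "of_real R"]]
      by (subst summable_on_iff_abs_summable_on_complex [symmetric])
    then show "((\<lambda>(i, j). norm (c N i j * of_real R ^ i * of_real R ^ j)) has_sum B) UNIV"
      unfolding B_def by (intro has_sum_infsum) (simp add: case_prod_unfold)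
    show "norm (case x of (i, j) \<Rightarrow> c N i j * z ^ i * w ^ j)
        \<le> (case x of (i, j) \<Rightarrow> norm (c N i j * of_real R ^ i * of_real R ^ j))" for x
      using that R(1)
      by (cases x) (auto simp: norm_mult norm_power intro!: mult_mono power_mono)
  qed
  have "\<forall>\<^sub>F n in sequentially. \<forall>i j. norm (c n i j) \<le> (B + 2) * (1 / R) ^ i * (1 / R) ^ j"
    using ev
  proof eventually_elim
    case (elim n)
    have bound: "norm (Q n z w) \<le> B + 2" if "norm z = R" "norm w = R" for z w
    proof -
      have "(z, w) \<in> ?K" using that by simp
      then have "dist (Q n z w) (L (z, w)) < 1" "dist (Q N z w) (L (z, w)) < 1"
        using elim N[of "(z, w)"] by auto
      then have "dist (Q n z w) (Q N z w) < 2"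
        by metric
      moreover have "norm (Q n z w) \<le> dist (Q n z w) (Q N z w) + norm (Q N z w)"
        by (simp add: dist_norm norm_triangle_sub add.commute)
      ultimately show ?thesis using QN[of z w] that by simp
    qed
    have "norm (c n i j) * R ^ i * R ^ j \<le> B + 2" for i j
      using has_sum bound
      by (intro double_power_series_coeff_bound[OF R(1)]) (auto simp: has_sum_iff)
    then show ?case using R(1) by (simp add: field_simps)
  qed
  then show thesis by (intro that[of "B + 2"]) (simp add: c_def)
qed

text \<open>Only the coefficients matter, so the series is an arbitrary entire one. As the
  \<open>c n k l\<close> sum to 1, the normalized \<open>T n\<close> minus 1 is the sum of
  \<open>c n k l * (p n k * p (m n) l - 1)\<close>, dominated by a vanishing multiple of a fixed
  convergent sum.\<close>

lemma asymp_equiv_marked_sum: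
  fixes F :: "complex fps fps" and m :: "nat \<Rightarrow> nat"
  assumes entire: "entire_zw F" and D: "open D" "cball 0 1 \<subseteq> D"
    and m: "filterlim m at_top sequentially" and lim: "rescaled_limit F m D L"
    and T: "\<And>n. T n = (\<Sum>k\<le>n. \<Sum>l\<le>m n. of_nat (n choose k) * of_nat (m n choose l) *
      of_nat n ^ (2 * (m n - l)) * (coeff_zw F k l * (2 ^ l * fact l * fact k)))"
  shows "T \<sim>[sequentially]
    (\<lambda>n. of_nat n ^ (2 * m n) * eval_zw F (of_nat n) (2 * of_nat (m n) / of_nat n ^ 2))"
proof -
  define A where "A n = eval_zw F (of_nat n) (2 * of_nat (m n) / of_nat n ^ 2)" for n
  define c where "c n i j = coeff_zw F i j * of_nat n ^ i * (2 * of_nat (m n) / of_nat n ^ 2) ^ j / A n"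
    for n i j
  define p where "p N k = real (N choose k) * fact k / real N ^ k" for N k
  \<comment> \<open>\<open>h R\<close> joins the geometric decay of the coefficients to the
    quadratic error; the \<open>+ 1\<close> lets one product \<open>h R i * h R j\<close> dominate
    the errors of both variables.\<close>
  define h where "h R k = (real k ^ 2 + 1) * (1 / R) ^ k" for R k
  obtain R where R: "R > 1" "cball 0 R \<subseteq> D"
    using open_supset_unit_cball_obtain_radius[OF D] .
  obtain M where M: "\<forall>\<^sub>F n in sequentially. \<forall>i j. norm (c n i j) \<le> M * (1 / R) ^ i * (1 / R) ^ j"
    using rescaled_coeff_bound[OF entire _ R(2) lim] R(1) unfolding c_def A_def by force
  define S where "S = (\<Sum>\<^sub>\<infinity>(i, j). h R i * h R j)"
  have "(\<lambda>(i, j). h R i * h R j) summable_on UNIV \<times> UNIV"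
    unfolding h_def using R(1)
    by (intro summable_on_product_nonneg summable_on_square_geometric) auto
  then have hS: "((\<lambda>(i, j). h R i * h R j) has_sum S) UNIV"
    unfolding S_def by simp
  have A_nz: "\<forall>\<^sub>F n in sequentially. A n \<noteq> 0"
    using lim by (simp add: rescaled_limit_def A_def)
  have m_pos: "\<forall>\<^sub>F n in sequentially. m n > 0"
    using m by (auto simp: filterlim_at_top_ge[of _ _ 1] Suc_le_eq)
  have "\<forall>\<^sub>F n in sequentially. norm (T n / (of_nat n ^ (2 * m n) * A n) - 1)
      \<le> M * (1 / real n + 1 / real (m n)) * S"
    using M A_nz m_pos eventually_gt_at_top[of 0]
  proof eventually_elim
    case (elim n)
    have p: "0 \<le> p n k" "p n k \<le> 1" "1 - p n k \<le> real k ^ 2 / real n"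
      "0 \<le> p (m n) k" "p (m n) k \<le> 1" "1 - p (m n) k \<le> real k ^ 2 / real (m n)" for k
      using falling_ratio_bounds[of n k] falling_ratio_bounds[of "m n" k] elim by (simp_all add: p_def)
    have "((\<lambda>(i, j). coeff_zw F i j * of_nat n ^ i * (2 * of_nat (m n) / of_nat n ^ 2) ^ j)
        has_sum A n) UNIV"
      using entire unfolding entire_zw_def eval_zw_def A_def by (intro has_sum_infsum) blast
    from has_sum_divide_const[OF this, of "A n"]
    have one: "((\<lambda>(i, j). c n i j) has_sum 1) UNIV"
      using elim by (simp add: c_def case_prod_unfold)
    \<comment> \<open>Dividing by \<open>n^(2m)\<close> leaves \<open>1 / n^(2l)\<close>; with
      \<open>(m choose l) * l! * 2^l\<close> this is \<open>p m l\<close> times the power of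
      \<open>2m/n^2\<close> contained in \<open>c\<close>.\<close>
    have "T n / (of_nat n ^ (2 * m n) * A n)
        = (\<Sum>k\<le>n. \<Sum>l\<le>m n. c n k l * of_real (p n k * p (m n) l))"
      unfolding T sum_divide_distrib
    proof (intro sum.cong refl)
      fix k l assume kl: "k \<in> {..n}" "l \<in> {..m n}"
      have "of_nat n ^ (2 * m n) = of_nat n ^ (2 * (m n - l)) * (of_nat n ^ (2 * l) :: complex)"
        using kl by (simp flip: power_add distrib_left)
      then show "of_nat (n choose k) * of_nat (m n choose l) *
          of_nat n ^ (2 * (m n - l)) * (coeff_zw F k l * (2 ^ l * fact l * fact k)) /
          (of_nat n ^ (2 * m n) * A n) = c n k l * of_real (p n k * p (m n) l)"
        using elim by (simp add: c_def p_def power_divide power_mult_distrib mult_ac flip: power_mult)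
    qed
    also have "\<dots> = (\<Sum>(k, l)\<in>{..n} \<times> {..m n}. c n k l * of_real (p n k * p (m n) l))"
      by (rule sum.cartesian_product)
    \<comment> \<open>Beyond the finite range the binomial coefficients vanish, so the sum extends
      to all pairs.\<close>
    finally have "((\<lambda>(i, j). c n i j * of_real (p n i * p (m n) j)) has_sum
        (T n / (of_nat n ^ (2 * m n) * A n))) UNIV"
      by (intro has_sum_finite_neutralI[of "{..n} \<times> {..m n}"]) (auto simp: p_def not_le)
    from has_sum_add[OF this has_sum_uminusI[OF one]]
    have diff: "((\<lambda>(i, j). c n i j * of_real (p n i * p (m n) j - 1)) has_sum
        (T n / (of_nat n ^ (2 * m n) * A n) - 1)) UNIV"
      by (simp add: case_prod_unfold algebra_simps)
    have "((\<lambda>(i, j). M * (1 / real n + 1 / real (m n)) * (h R i * h R j)) has_sum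
        M * (1 / real n + 1 / real (m n)) * S) UNIV"
      using has_sum_cmult_right[OF hS] by (simp add: case_prod_unfold)
    with diff show ?case
    proof (rule norm_infsum_le)
      fix x :: "nat \<times> nat"
      obtain i j where x: "x = (i, j)" by (cases x)
      \<comment> \<open>From \<open>(1 - x)(1 - y) \<ge> 0\<close>: the defects of the two ratios at
        most add up.\<close>
      have "1 - p n i * p (m n) j \<le> (1 - p n i) + (1 - p (m n) j)"
        using mult_nonneg_nonneg[of "1 - p n i" "1 - p (m n) j"] p by (simp add: algebra_simps)
      also have "\<dots> \<le> real i ^ 2 / real n + real j ^ 2 / real (m n)"
        using p by (intro add_mono)
      also have "\<dots> \<le> ((real i ^ 2 + 1) * (real j ^ 2 + 1)) / real n
          + ((real i ^ 2 + 1) * (real j ^ 2 + 1)) / real (m n)"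
        by (intro add_mono divide_right_mono) (simp_all add: algebra_simps)
      finally have le: "1 - p n i * p (m n) j
          \<le> (1 / real n + 1 / real (m n)) * ((real i ^ 2 + 1) * (real j ^ 2 + 1))"
        by (simp add: algebra_simps add_divide_distrib)
      have "p n i * p (m n) j \<le> 1" using p by (simp add: mult_le_one)
      then have "norm (c n i j * of_real (p n i * p (m n) j - 1)) = norm (c n i j) * (1 - p n i * p (m n) j)"
        unfolding norm_mult norm_of_real by simp
      also have "\<dots> \<le> (M * (1 / R) ^ i * (1 / R) ^ j) *
          ((1 / real n + 1 / real (m n)) * ((real i ^ 2 + 1) * (real j ^ 2 + 1)))"
        using elim le \<open>p n i * p (m n) j \<le> 1\<close>
        by (intro mult_mono) (auto intro: order_trans[OF norm_ge_zero])
      finally show "norm (case x of (i, j) \<Rightarrow> c n i j * of_real (p n i * p (m n) j - 1))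
          \<le> (case x of (i, j) \<Rightarrow> M * (1 / real n + 1 / real (m n)) * (h R i * h R j))"
        by (simp add: x h_def mult_ac)
    qed
  qed
  moreover have "(\<lambda>n. M * (1 / real n + 1 / real (m n)) * S) \<longlonglongrightarrow> 0"
  proof -
    have "(\<lambda>n. M * (1 / real n + 1 / real (m n)) * S) \<longlonglongrightarrow> M * (0 + 0) * S"
      using filterlim_compose[OF lim_1_over_n m] by (intro tendsto_intros lim_1_over_n)
    then show ?thesis by simp
  qed
  ultimately have "(\<lambda>n. T n / (of_nat n ^ (2 * m n) * A n) - 1) \<longlonglongrightarrow> 0"
    by (rule Lim_null_comparison)
  then have "(\<lambda>n. T n / (of_nat n ^ (2 * m n) * A n)) \<longlonglongrightarrow> 1"
    by (simp add: LIM_zero_iff)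
  then show ?thesis
    unfolding A_def by (rule asymp_equivI')
qed

text \<open>The factor \<open>2 ^ l * fact l * fact k\<close> undoes the normalization in
  \<open>weighted_gf\<close> and recovers the total weight of a slice, so the finite sum has the
  form required of \<open>T\<close>.\<close>

lemma asymp_equiv_weighted_MG:
  assumes \<F>: "multigraph_family \<F>" and \<omega>: "iso_invariant_weight \<F> \<omega>"
    and "entire_zw (weighted_gf \<F> \<omega>)" "open D" "cball 0 1 \<subseteq> D"
    and "filterlim m at_top sequentially" "rescaled_limit (weighted_gf \<F> \<omega>) m D L"
  shows "(\<lambda>n. weighted_MG \<F> \<omega> n (m n)) \<sim>[sequentially]
    (\<lambda>n. of_nat n ^ (2 * m n) *
      eval_zw (weighted_gf \<F> \<omega>) (of_nat n) (2 * of_nat (m n) / of_nat n ^ 2))"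
  by (rule asymp_equiv_marked_sum[OF assms(3-7)])
    (simp add: weighted_MG_eq_sum[OF \<F> \<omega>] coeff_weighted_gf)

theorem theorem5p1:
  fixes \<F> :: "mgraph set" and \<omega> :: "mgraph \<Rightarrow> complex"
  assumes family: "multigraph_family \<F>"
    and weight: "iso_invariant_weight \<F> \<omega>"
  shows
    "(\<forall>n m. of_nat (MG \<F> n m) =
        fact n * 2 ^ m * fact m *
        coeff_zw (family_gf \<F> * exp_z * exp_cw (of_nat n ^ 2 / 2)) n m) \<and>
     (\<forall>n m. weighted_MG \<F> \<omega> n m =
        fact n * 2 ^ m * fact m *
        coeff_zw (weighted_gf \<F> \<omega> * exp_z * exp_cw (of_nat n ^ 2 / 2)) n m) \<and>
     (entire_zw (family_gf \<F>) \<longrightarrow>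
        (\<forall>D L m. open D \<and> cball 0 1 \<subseteq> D \<and> filterlim m at_top sequentially \<and>
           analytic_on_C2 L (D \<times> D) \<and> rescaled_limit (family_gf \<F>) m D L \<longrightarrow>
           (\<lambda>n. of_nat (MG \<F> n (m n))) \<sim>[sequentially]
           (\<lambda>n. of_nat n ^ (2 * m n) *
                 eval_zw (family_gf \<F>) (of_nat n) (2 * of_nat (m n) / of_nat n ^ 2)))) \<and>
     (entire_zw (weighted_gf \<F> \<omega>) \<longrightarrow>
        (\<forall>D L m. open D \<and> cball 0 1 \<subseteq> D \<and> filterlim m at_top sequentially \<and>
           analytic_on_C2 L (D \<times> D) \<and> rescaled_limit (weighted_gf \<F> \<omega>) m D L \<longrightarrow>
           (\<lambda>n. weighted_MG \<F> \<omega> n (m n)) \<sim>[sequentially]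
           (\<lambda>n. of_nat n ^ (2 * m n) *
                 eval_zw (weighted_gf \<F> \<omega>) (of_nat n) (2 * of_nat (m n) / of_nat n ^ 2))))"
proof -
  have one: "iso_invariant_weight \<F> (\<lambda>_. 1)"
    by (simp add: iso_invariant_weight_def)
  show ?thesis
    unfolding of_nat_MG_eq_weighted_MG family_gf_def
    using weighted_MG_eq_coeff[OF family one] weighted_MG_eq_coeff[OF family weight]
      asymp_equiv_weighted_MG[OF family one] asymp_equiv_weighted_MG[OF family weight]
    by (intro conjI allI impI) blast+
qed

end
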